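(* Let $\Omega$ be a domain in $\mathbb{R}^{m+n}$, $m,n\geq 2$, and $K\geq 1$. Let $u:\Omega\to\mathbb{R}$ be such that (a) for each $y\in\mathbb{R}^n$ the function $\Omega(y)\ni x\mapsto u(x,y)\in\mathbb{R}$ is $K$-quasi-nearly subharmonic n.s., (b) for each $x\in\mathbb{R}^m$ the function $\Omega(x)\ni y\mapsto u(x,y)\in\mathbb{R}$ is harmonic, (c) there is a nonnegative function $\varphi\in\mathcal{L}^1_{\mathrm{loc}}(\Omega)$ such that $-\varphi\leq u$. Then $u$ is $K$-quasi-nearly subharmonic n.s. in $\Omega$.
   Context: Points of $\mathbb{R}^{m+n}$ are written $(x,y)$ with $x\in\mathbb{R}^m$, $y\in\mathbb{R}^n$. For $\Omega\subset\mathbb{R}^{m+n}$ put $\Omega(y)=\{x\in\mathbb{R}^m:(x,y)\in\Omega\}$ and $\Omega(x)=\{y\in\mathbb{R}^n:(x,y)\in\Omega\}$ (open, possibly empty or disconnected; the definition below is applied verbatim on them). $m_N$ is Lebesgue measure on $\mathbb{R}^N$, $B^N(x,r)$ the open ball, $\nu_N=m_N(B^N(0,1))$, and $u^+=\max\{u,0\}$. Let $D\subset\mathbb{R}^N$ be open, $N\ge2$, and $K\geq1$. A Lebesgue measurable function $u:D\to[-\infty,+\infty)$ is $K$-quasi-nearly subharmonic n.s. (in the narrow sense) if $u^+\in\mathcal{L}^1_{\mathrm{loc}}(D)$ and for all closed balls $\overline{B^N(x,r)}\subset D$, $$u(x)\leq\frac{K}{\nu_N r^N}\int_{B^N(x,r)}u\,dm_N.$$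 *)

theory Defs
  imports "HOL-Analysis.Analysis"
begin

text \<open>
  Functions on a set \<open>D\<close> are total functions of which only the values on \<open>D\<close> matter.
  Extended real values are used because quasi-nearly subharmonic functions may take the
  value \<open>-\<infinity>\<close>.
\<close>

definition locally_integrable_on :: "('a::euclidean_space \<Rightarrow> ereal) \<Rightarrow> 'a set \<Rightarrow> bool"
    (infix "locally'_integrable'_on" 50) where
  "f locally_integrable_on D \<longleftrightarrow>
     f \<in> borel_measurable (lebesgue_on D) \<and>
     (\<forall>S. compact S \<and> S \<subseteq> D \<longrightarrow> (\<integral>\<^sup>+x\<in>S. e2ennreal \<bar>f x\<bar> \<partial>lebesgue) < \<infinity>)"

text \<open>
  The Lebesgue integral as the integral of the positive part minus the integral of the
  negative part.  It is meaningful when the first of these is finite, and then it may be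
  \<open>-\<infinity>\<close>; the Bochner integral would give \<open>0\<close> in that case.
\<close>

definition ereal_integral_over :: "'a::euclidean_space set \<Rightarrow> ('a \<Rightarrow> ereal) \<Rightarrow> ereal" where
  "ereal_integral_over S f =
     enn2ereal (\<integral>\<^sup>+x\<in>S. e2ennreal (max 0 (f x)) \<partial>lebesgue) -
     enn2ereal (\<integral>\<^sup>+x\<in>S. e2ennreal (max 0 (- f x)) \<partial>lebesgue)"

text \<open>Used only for open \<open>D\<close>, dimension at least \<open>2\<close> and \<open>K \<ge> 1\<close>.\<close>

definition quasi_nearly_subharmonic_ns ::
    "real \<Rightarrow> 'a::euclidean_space set \<Rightarrow> ('a \<Rightarrow> ereal) \<Rightarrow> bool" where
  "quasi_nearly_subharmonic_ns K D u \<longleftrightarrow>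
     u \<in> borel_measurable (lebesgue_on D) \<and>
     (\<forall>x\<in>D. u x < \<infinity>) \<and>
     (\<lambda>x. max 0 (u x)) locally_integrable_on D \<and>
     (\<forall>x r. r > 0 \<and> cball x r \<subseteq> D \<longrightarrow>
        u x \<le> ereal (K / (measure lebesgue (ball (0::'a) 1) * r ^ DIM('a)))
              * ereal_integral_over (ball x r) u)"

text \<open>
  Harmonic functions on an open set: twice continuously differentiable with vanishing
  Laplacian.  Here \<open>g\<close> is the gradient and \<open>H\<close> the Hessian of \<open>f\<close>, both uniquely determined
  on \<open>D\<close>, and the sum is the trace of \<open>H x\<close>, i.e. the sum of the pure second partial
  derivatives.
\<close>

definition harmonic_on :: "('a::euclidean_space \<Rightarrow> real) \<Rightarrow> 'a set \<Rightarrow> bool"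
    (infix "harmonic'_on" 50) where
  "f harmonic_on D \<longleftrightarrow>
     (\<exists>(g :: 'a \<Rightarrow> 'a) (H :: 'a \<Rightarrow> 'a \<Rightarrow>\<^sub>L 'a).
        (\<forall>x\<in>D. (f has_derivative (\<lambda>v. g x \<bullet> v)) (at x)) \<and>
        (\<forall>x\<in>D. (g has_derivative blinfun_apply (H x)) (at x)) \<and>
        continuous_on D H \<and>
        (\<forall>x\<in>D. (\<Sum>b\<in>Basis. blinfun_apply (H x) b \<bullet> b) = 0))"

end

theory Submission
  imports Defs
begin

text \<open>
  Two facts carry the proof: the mean value property of harmonic functions over solid balls,
  and Fubini's theorem used in both orders.

  Measurability.  Approximating the variable \<open>y\<close> by simple functions shows that \<open>u\<close>, being
  Lebesgue measurable in \<open>x\<close> and continuous in \<open>y\<close>, agrees on \<open>\<Omega>\<close> with a Borel function \<open>w\<close>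
  away from \<open>N \<times> UNIV\<close>, where \<open>N\<close> is a null set
  (\<open>caratheodory_function_borel_version\<close>).

  Local integrability.  Let \<open>A \<times> C\<close> be a product of balls with closure in \<open>\<Omega>\<close>, \<open>C\<close> with centre \<open>b\<close>.  Since
  \<open>\<bar>u\<bar> = u + 2 u\<^sup>-\<close>, the mean value property bounds the integral of \<open>\<bar>u(x, \<cdot>)\<bar>\<close> over \<open>C\<close> by
  \<open>\<bar>C\<bar> u\<^sup>+(x, b)\<close> plus twice the integral of \<open>u\<^sup>-(x, \<cdot>)\<close>.  Integrated over \<open>A\<close>, the first term
  is finite because \<open>u(\<cdot>, b)\<^sup>+\<close> is locally integrable, the second because \<open>u\<^sup>- \<le> \<phi>\<close>
  (\<open>nn_integral_abs_cylinder_finite\<close>).  So \<open>u\<close> itself is locally integrable.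

  Mean value inequality.  Let \<open>B\<close> be a ball with centre \<open>(x\<^sub>0, y\<^sub>0)\<close> whose closure lies in \<open>\<Omega>\<close>.
  Its slices in the direction of \<open>y\<close> are balls with centre \<open>y\<^sub>0\<close>, so by harmonicity the integral
  of \<open>u(x, y)\<close> over \<open>B\<close> equals that of \<open>u(x, y\<^sub>0)\<close>.  Its slices in the direction of \<open>x\<close> are
  balls with centre \<open>x\<^sub>0\<close>, and the mean value inequality of \<open>u(\<cdot>, y\<^sub>0)\<close> on each of them shows that
  the integral of \<open>u(x, y\<^sub>0)\<close> over \<open>B\<close> is at least \<open>\<bar>B\<bar> u(x\<^sub>0, y\<^sub>0) / K\<close>
  (\<open>ball_integral_ge_from_slices\<close>).  No formula for the volume of a ball is needed.

  Slicing and Fubini's theorem are carried out with \<open>w\<close> over \<open>lborel\<close>.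
\<close>

section \<open>The solid mean value property of harmonic functions\<close>

lemma AE_lborel_notin_sphere: "AE x in lborel. x \<notin> sphere (a::'a::euclidean_space) r"
proof -
  have "sphere a r \<in> null_sets lebesgue"
    using negligible_iff_null_sets negligible_sphere by blast
  moreover have "sphere a r \<in> sets lborel" by simp
  ultimately show ?thesis
    by (intro AE_not_in) (metis null_sets_completion_iff)
qed

text \<open>
  Translation invariance makes the integral of every difference quotient vanish; the Lipschitz
  bound allows passing to the limit.
\<close>

lemma integral_directional_derivative_eq_0:
  fixes F :: "'a::euclidean_space \<Rightarrow> real"
  assumes lip: "L-lipschitz_on UNIV F"
    and zero: "\<And>x. norm x > R \<Longrightarrow> F x = 0"
    and meas: "d \<in> borel_measurable lborel"
    and deriv: "AE x in lborel. ((\<lambda>t. F (x + t *\<^sub>R e)) has_real_derivative d x) (at 0)"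
  shows "integral\<^sup>L lborel d = 0"
proof -
  define s where "s k = inverse (real (Suc k))" for k
  define q where "q k x = (F (x + s k *\<^sub>R e) - F x) / s k" for k x
  have s: "s k > 0" "s k \<le> 1" for k by (auto simp: s_def field_simps)
  have contF: "continuous_on UNIV F"
    using lip by (rule lipschitz_on_continuous_on)
  have [measurable]: "F \<in> borel_measurable borel"
    using contF by (rule borel_measurable_continuous_onI)
  have intF: "integrable lborel F"
  proof -
    have "integrable lborel (\<lambda>x. indicator (cball 0 R) x *\<^sub>R F x)"
      by (intro borel_integrable_compact) (auto intro: continuous_on_subset[OF contF])
    also have "(\<lambda>x. indicator (cball 0 R) x *\<^sub>R F x) = F"
      using zero by (auto simp: indicator_def fun_eq_iff)
    finally show ?thesis .
  qed
  have shift: "integrable lborel (\<lambda>x. F (x + v))" "integral\<^sup>L lborel (\<lambda>x. F (x + v)) = integral\<^sup>L lborel F" for v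
  proof -
    have *: "distr lborel borel (\<lambda>x. v + x) = lborel"
      using lborel_affine[of 1 v] by (simp add: density_1)
    show "integral\<^sup>L lborel (\<lambda>x. F (x + v)) = integral\<^sup>L lborel F"
      by (subst (2) *[symmetric], subst integral_distr) (auto simp: add.commute)
    have "integrable (distr lborel borel (\<lambda>x. v + x)) F" using * intF by simp
    then show "integrable lborel (\<lambda>x. F (x + v))"
      by (subst (asm) integrable_distr_eq) (auto simp: add.commute)
  qed
  have q0: "integral\<^sup>L lborel (q k) = 0" for k
    unfolding q_def by (simp add: shift intF)
  have lim: "(\<lambda>k. integral\<^sup>L lborel (q k)) \<longlonglongrightarrow> integral\<^sup>L lborel d"
  proof (rule integral_dominated_convergence)
    show "d \<in> borel_measurable lborel" by fact
    show "q k \<in> borel_measurable lborel" for k unfolding q_def by measurable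
    show "integrable lborel (\<lambda>x. indicator (cball 0 (R + norm e)) x *\<^sub>R (L * norm e))"
      by (intro borel_integrable_compact) auto
    show "AE x in lborel. (\<lambda>k. q k x) \<longlonglongrightarrow> d x"
      using deriv
    proof eventually_elim
      case (elim x)
      have "filterlim s (at 0) sequentially"
        unfolding filterlim_at s_def using LIMSEQ_inverse_real_of_nat by auto
      with elim show ?case
        unfolding has_field_derivative_def has_derivative_def q_def
        using elim[unfolded DERIV_def] by (auto dest: filterlim_compose simp: q_def)
    qed
    show "AE x in lborel. norm (q k x) \<le> indicator (cball 0 (R + norm e)) x *\<^sub>R (L * norm e)" for k
    proof (intro AE_I2)
      fix x
      show "norm (q k x) \<le> indicator (cball 0 (R + norm e)) x *\<^sub>R (L * norm e)"
      proof (cases "norm x \<le> R + norm e")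
        case True
        have "\<bar>F (x + s k *\<^sub>R e) - F x\<bar> \<le> L * (s k * norm e)"
          using lipschitz_onD[OF lip, of "x + s k *\<^sub>R e" x] s[of k] by (simp add: dist_norm)
        with True s[of k] show ?thesis
          by (simp add: q_def abs_divide field_simps)
      next
        case False
        have "norm (s k *\<^sub>R e) \<le> norm e" using s[of k] by (simp add: mult_left_le_one_le)
        with False have "norm (x + s k *\<^sub>R e) > R" "norm x > R"
          using norm_diff_ineq[of x "s k *\<^sub>R e"] norm_ge_zero[of e] by linarith+
        with False show ?thesis by (simp add: q_def zero)
      qed
    qed
  qed
  show ?thesis using lim unfolding q0 by (simp add: LIMSEQ_const_iff)
qed

text \<open>
  With \<open>G y = g (b + s y)\<close>, the divergence of the field \<open>(1 - \<bar>y\<bar>\<^sup>2) G y\<close> is \<open>- 2 y \<bullet> G y\<close>, because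
  the Jacobian of \<open>g\<close> has trace zero.  The field vanishes on the unit sphere, so the integral of
  its divergence over the ball is zero.
\<close>

lemma integral_radial_derivative_harmonic_eq_0:
  fixes g :: "'a::euclidean_space \<Rightarrow> 'a" and H :: "'a \<Rightarrow> 'a \<Rightarrow>\<^sub>L 'a"
  assumes g: "\<And>x. x \<in> D \<Longrightarrow> (g has_derivative blinfun_apply (H x)) (at x)"
    and H: "continuous_on D H"
    and trace: "\<And>x. x \<in> D \<Longrightarrow> (\<Sum>i\<in>Basis. blinfun_apply (H x) i \<bullet> i) = 0"
    and D: "\<And>y. y \<in> cball 0 1 \<Longrightarrow> b + s *\<^sub>R y \<in> D"
  shows "(\<integral>y. indicator (cball 0 1) y *\<^sub>R (g (b + s *\<^sub>R y) \<bullet> y) \<partial>lborel) = 0"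
proof -
  \<comment> \<open>Composition with this projection extends a function on the ball that vanishes on the sphere
    by zero, and does not increase its Lipschitz constant.\<close>
  define p where "p = closest_point (cball (0::'a) 1)"
  have contg: "continuous_on (cball 0 1) (\<lambda>y. g (b + s *\<^sub>R y))"
  proof (rule continuous_on_compose2[of D g])
    show "continuous_on D g"
      by (intro continuous_at_imp_continuous_on ballI) (rule has_derivative_continuous[OF g])
  qed (auto intro!: continuous_intros D[unfolded mem_cball])
  have contH: "continuous_on (cball 0 1) (\<lambda>y. H (b + s *\<^sub>R y))"
    by (rule continuous_on_compose2[OF H]) (auto intro!: continuous_intros D[unfolded mem_cball])
  obtain C1 where C1: "\<And>y. y \<in> cball 0 1 \<Longrightarrow> norm (g (b + s *\<^sub>R y)) \<le> C1"
    using compact_imp_bounded[OF compact_continuous_image[OF contg compact_cball]]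
    unfolding bounded_iff by blast
  obtain C2 where C2: "\<And>y. y \<in> cball 0 1 \<Longrightarrow> norm (H (b + s *\<^sub>R y)) \<le> C2"
    using compact_imp_bounded[OF compact_continuous_image[OF contH compact_cball]]
    unfolding bounded_iff by blast
  \<comment> \<open>the \<open>i\<close>-th term of the divergence\<close>
  define d where "d i y = indicator (cball 0 1) y *\<^sub>R
      (- 2 * (y \<bullet> i) * (g (b + s *\<^sub>R y) \<bullet> i) + (1 - y \<bullet> y) * (s * (H (b + s *\<^sub>R y) i \<bullet> i)))" for i y
  have int_d: "integrable lborel (d i)" for i
    unfolding d_def
    by (intro borel_integrable_compact continuous_intros contg contH) auto
  have "integral\<^sup>L lborel (d i) = 0" if i: "i \<in> Basis" for i
  proof -
    define \<Phi> where "\<Phi> y = (1 - y \<bullet> y) * (g (b + s *\<^sub>R y) \<bullet> i)" for y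
    define \<Phi>' where "\<Phi>' y v = - 2 * (y \<bullet> v) * (g (b + s *\<^sub>R y) \<bullet> i) + (1 - y \<bullet> y) * (s * (H (b + s *\<^sub>R y) v \<bullet> i))" for y v
    have der: "(\<Phi> has_derivative \<Phi>' y) (at y)" if "y \<in> cball 0 1" for y
    proof -
      have "((\<lambda>y. g (b + s *\<^sub>R y)) has_derivative (\<lambda>v. H (b + s *\<^sub>R y) (s *\<^sub>R v))) (at y)"
        by (rule has_derivative_compose[of "\<lambda>y. b + s *\<^sub>R y", OF _ g[OF D[OF that]]])
           (auto intro!: derivative_eq_intros)
      then show ?thesis
        unfolding \<Phi>_def \<Phi>'_def
        by (auto intro!: derivative_eq_intros simp: blinfun.scaleR_right inner_commute algebra_simps)
    qed
    have on: "onorm (\<Phi>' y) \<le> 2 * C1 + \<bar>s\<bar> * C2" if y: "y \<in> cball 0 1" for y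
    proof (rule onorm_bound)
      have C: "0 \<le> C1" "0 \<le> C2" using C1[OF y] C2[OF y] norm_ge_zero order_trans by blast+
      then show "0 \<le> 2 * C1 + \<bar>s\<bar> * C2" by simp
      fix v
      have ny: "norm y \<le> 1" using y by simp
      have "\<bar>y \<bullet> v\<bar> \<le> 1 * norm v"
        by (rule order_trans[OF Cauchy_Schwarz_ineq2]) (intro mult_right_mono ny, simp)
      moreover have "\<bar>g (b + s *\<^sub>R y) \<bullet> i\<bar> \<le> C1"
        using Cauchy_Schwarz_ineq2[of "g (b + s *\<^sub>R y)" i] i C1[OF y] by simp
      ultimately have 1: "\<bar>y \<bullet> v\<bar> * \<bar>g (b + s *\<^sub>R y) \<bullet> i\<bar> \<le> norm v * C1"
        by (intro mult_mono) auto
      have yy: "0 \<le> 1 - y \<bullet> y" "1 - y \<bullet> y \<le> 1"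
        using ny by (auto simp: dot_square_norm power_le_one)
      have "\<bar>H (b + s *\<^sub>R y) v \<bullet> i\<bar> \<le> norm (H (b + s *\<^sub>R y) v)"
        using Cauchy_Schwarz_ineq2[of "H (b + s *\<^sub>R y) v" i] i by simp
      also have "\<dots> \<le> C2 * norm v"
        by (rule order_trans[OF norm_blinfun]) (intro mult_right_mono C2 y, simp)
      finally have "(1 - y \<bullet> y) * (\<bar>s\<bar> * \<bar>H (b + s *\<^sub>R y) v \<bullet> i\<bar>) \<le> 1 * (\<bar>s\<bar> * (C2 * norm v))"
        using yy by (intro mult_mono) auto
      then have 2: "\<bar>(1 - y \<bullet> y) * (s * (H (b + s *\<^sub>R y) v \<bullet> i))\<bar> \<le> \<bar>s\<bar> * (C2 * norm v)"
        using yy by (simp add: abs_mult)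
      have "\<bar>\<Phi>' y v\<bar> \<le> \<bar>- 2 * (y \<bullet> v) * (g (b + s *\<^sub>R y) \<bullet> i)\<bar> + \<bar>(1 - y \<bullet> y) * (s * (H (b + s *\<^sub>R y) v \<bullet> i))\<bar>"
        unfolding \<Phi>'_def by (rule abs_triangle_ineq)
      also have "\<dots> \<le> 2 * (norm v * C1) + \<bar>s\<bar> * (C2 * norm v)"
        using 1 2 by (intro add_mono) (simp_all add: abs_mult)
      finally show "norm (\<Phi>' y v) \<le> (2 * C1 + \<bar>s\<bar> * C2) * norm v"
        by (simp add: algebra_simps)
    qed
    define L where "L = 2 * C1 + \<bar>s\<bar> * C2"
    have L0: "0 \<le> L" 
      using order_trans[OF norm_ge_zero C1[of 0]] order_trans[OF norm_ge_zero C2[of 0]]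
      unfolding L_def by simp
    define F where "F = \<Phi> \<circ> p"
    have p_in: "p y \<in> cball 0 1" for y unfolding p_def by (rule closest_point_in_set) auto
    have lip: "L-lipschitz_on UNIV F"
    proof (rule lipschitz_onI)
      fix x y :: 'a
      have "norm (\<Phi> (p x) - \<Phi> (p y)) \<le> L * norm (p x - p y)"
        by (rule differentiable_bound[of "cball 0 1" _ \<Phi>'])
           (use der on p_in in \<open>auto simp: L_def intro: has_derivative_at_withinI\<close>)
      also have "\<dots> \<le> L * dist x y"
        using closest_point_lipschitz[of "cball (0::'a) 1" x y] L0
        by (intro mult_left_mono) (auto simp: p_def dist_norm)
      finally show "dist (F x) (F y) \<le> L * dist x y"
        by (simp add: F_def dist_norm)
    qed (rule L0)
    have F_in: "F y = \<Phi> y" if "y \<in> cball 0 1" for y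
      using closest_point_self[OF that] by (simp add: F_def p_def)
    have F_out: "F y = 0" if "norm y > 1" for y
    proof -
      have "p y \<in> frontier (cball 0 1)" unfolding p_def
        using that closest_point_in_rel_frontier[of "cball (0::'a) 1" y]
        by (simp add: affine_hull_nonempty_interior rel_interior_nonempty_interior rel_frontier_nonempty_interior)
      then have "norm (p y) = 1" by (simp add: frontier_cball)
      then show ?thesis by (simp add: F_def \<Phi>_def dot_square_norm)
    qed
    show ?thesis
    proof (rule integral_directional_derivative_eq_0[OF lip F_out])
      show "d i \<in> borel_measurable lborel" using int_d by auto
      show "AE x in lborel. ((\<lambda>t. F (x + t *\<^sub>R i)) has_real_derivative d i x) (at 0)"
        using AE_lborel_notin_sphere[of 0 1]
      proof eventually_elim
        case (elim y)
        have aff: "((\<lambda>t. y + t *\<^sub>R i) has_derivative (\<lambda>t. t *\<^sub>R i)) (at 0)"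
          by (auto intro!: derivative_eq_intros)
        consider "norm y < 1" | "norm y > 1" using elim by fastforce
        then have "(F has_derivative (\<lambda>v. if norm y < 1 then \<Phi>' y v else 0)) (at y)"
        proof cases
          case 1
          have "(F has_derivative \<Phi>' y) (at y)"
            by (rule has_derivative_transform_within_open[OF der open_ball[of 0 1]])
               (use 1 F_in in auto)
          then show ?thesis using 1 by simp
        next
          case 2
          have "((\<lambda>_. 0) has_derivative (\<lambda>_. 0)) (at y)" by simp
          then have "(F has_derivative (\<lambda>_. 0)) (at y)"
            by (rule has_derivative_transform_within_open[of _ _ _ _ "- cball 0 1"])
               (use 2 F_out in auto)
          then show ?thesis using 2 by simp
        qed
        then have "((\<lambda>t. F (y + t *\<^sub>R i)) has_derivative (\<lambda>t. if norm y < 1 then \<Phi>' y (t *\<^sub>R i) else 0)) (at 0)"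
          using has_derivative_compose[OF aff, of F] by simp
        moreover have "(\<lambda>t. if norm y < 1 then \<Phi>' y (t *\<^sub>R i) else 0) = (*) (d i y)"
          using elim by (auto simp: fun_eq_iff d_def \<Phi>'_def blinfun.scaleR_right algebra_simps indicator_def)
        ultimately show ?case unfolding has_field_derivative_def by simp
      qed
    qed simp
  qed
  then have "(\<Sum>i\<in>Basis. integral\<^sup>L lborel (d i)) = 0" by simp
  then have "integral\<^sup>L lborel (\<lambda>y. \<Sum>i\<in>Basis. d i y) = 0"
    by (simp add: int_d)
  moreover have "(\<Sum>i\<in>Basis. d i y) = - 2 * (indicator (cball 0 1) y *\<^sub>R (g (b + s *\<^sub>R y) \<bullet> y))" for y
  proof (cases "y \<in> cball 0 1")
    case True
    have "(\<Sum>i\<in>Basis. d i y) = - 2 * (\<Sum>i\<in>Basis. (g (b + s *\<^sub>R y) \<bullet> i) * (y \<bullet> i))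
        + (1 - y \<bullet> y) * s * (\<Sum>i\<in>Basis. H (b + s *\<^sub>R y) i \<bullet> i)"
      using True by (simp add: d_def sum.distrib sum_distrib_left sum_negf sum_subtractf mult_ac)
    also have "(\<Sum>i\<in>Basis. (g (b + s *\<^sub>R y) \<bullet> i) * (y \<bullet> i)) = g (b + s *\<^sub>R y) \<bullet> y"
      by (rule euclidean_inner[symmetric])
    finally show ?thesis using True by (simp add: trace[OF D[OF True]])
  qed (simp add: d_def)
  ultimately show ?thesis by simp
qed

lemma harmonic_on_continuous_on: "f harmonic_on D \<Longrightarrow> continuous_on D f"
  unfolding harmonic_on_def
  by (intro continuous_at_imp_continuous_on ballI) (blast intro: has_derivative_continuous)

text \<open>
  Write \<open>f (b + r y) - f b\<close> as the integral over \<open>s \<in> [0, r]\<close> of the radial derivative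
  \<open>g (b + s y) \<bullet> y\<close>, and integrate over \<open>y\<close> in the unit ball first.
\<close>

lemma harmonic_on_mean_value_cball:
  fixes f :: "'a::euclidean_space \<Rightarrow> real"
  assumes f: "f harmonic_on D" and D: "cball b r \<subseteq> D" and r: "0 < r"
  shows "(\<integral>z. indicator (cball b r) z *\<^sub>R (f z - f b) \<partial>lborel) = 0"
proof -
  obtain g :: "'a \<Rightarrow> 'a" and H :: "'a \<Rightarrow> 'a \<Rightarrow>\<^sub>L 'a" where
    gH: "\<forall>x\<in>D. (f has_derivative (\<lambda>v. g x \<bullet> v)) (at x)"
      "\<forall>x\<in>D. (g has_derivative blinfun_apply (H x)) (at x)"
      "continuous_on D H" "\<forall>x\<in>D. (\<Sum>i\<in>Basis. blinfun_apply (H x) i \<bullet> i) = 0"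
    using f unfolding harmonic_on_def by blast
  note g = gH(1)[rule_format] and H = gH(2)[rule_format] gH(3) gH(4)[rule_format]
  have in_D: "b + s *\<^sub>R y \<in> D" if "y \<in> cball 0 1" "s \<in> {0..r}" for s y
  proof -
    have "\<bar>s\<bar> * norm y \<le> r * 1" using that r by (intro mult_mono) auto
    then show ?thesis using D by (auto simp: dist_norm)
  qed
  have contf: "continuous_on D f" using f by (rule harmonic_on_continuous_on)
  have contg: "continuous_on D g"
    by (intro continuous_at_imp_continuous_on ballI) (rule has_derivative_continuous[OF H(1)])
  define k where "k = (\<lambda>(s, y). g (b + s *\<^sub>R y) \<bullet> y)"
  define W where "W = {0..r} \<times> cball (0::'a) 1"
  have "continuous_on W (\<lambda>p. g (b + fst p *\<^sub>R snd p))"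
    by (rule continuous_on_compose2[OF contg]) (use in_D in \<open>auto intro!: continuous_intros simp: W_def\<close>)
  then have "integrable lborel (\<lambda>p. indicator W p *\<^sub>R k p)"
    by (intro borel_integrable_compact)
       (auto intro!: continuous_intros compact_Times simp: W_def k_def case_prod_beta)
  then have int: "integrable (lborel \<Otimes>\<^sub>M lborel) (\<lambda>(s, y). indicator W (s, y) *\<^sub>R k (s, y))"
    by (simp add: lborel_prod split_def)
  have radial: "(\<integral>y. indicator W (s, y) *\<^sub>R k (s, y) \<partial>lborel) = 0" for s
  proof (cases "s \<in> {0..r}")
    case True
    have "(\<integral>y. indicator W (s, y) *\<^sub>R k (s, y) \<partial>lborel)
        = (\<integral>y. indicator (cball 0 1) y *\<^sub>R (g (b + s *\<^sub>R y) \<bullet> y) \<partial>lborel)"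
      using True by (intro Bochner_Integration.integral_cong) (auto simp: W_def k_def indicator_def)
    also have "\<dots> = 0"
      by (rule integral_radial_derivative_harmonic_eq_0[OF H]) (use True in_D in auto)
    finally show ?thesis .
  qed (auto simp: W_def)
  have ftc: "(\<integral>s. indicator W (s, y) *\<^sub>R k (s, y) \<partial>lborel) = indicator (cball 0 1) y *\<^sub>R (f (b + r *\<^sub>R y) - f b)" for y
  proof (cases "y \<in> cball 0 1")
    case True
    have "(\<integral>s. indicator W (s, y) *\<^sub>R k (s, y) \<partial>lborel) = (\<integral>s. indicator {0..r} s *\<^sub>R k (s, y) \<partial>lborel)"
      using True by (intro Bochner_Integration.integral_cong) (auto simp: W_def indicator_def)
    also have "\<dots> = f (b + r *\<^sub>R y) - f (b + 0 *\<^sub>R y)"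
    proof (rule integral_FTC_Icc)
      show "continuous_on {0..r} (\<lambda>s. k (s, y))"
        unfolding k_def split
        by (intro continuous_intros continuous_on_compose2[OF contg]) (use True in_D in auto)
      fix s assume "0 \<le> s" "s \<le> r"
      then have "b + s *\<^sub>R y \<in> D" using True in_D by auto
      then have "((\<lambda>s. f (b + s *\<^sub>R y)) has_derivative (\<lambda>t. g (b + s *\<^sub>R y) \<bullet> (t *\<^sub>R y))) (at s)"
        by (intro has_derivative_compose[of "\<lambda>s. b + s *\<^sub>R y", OF _ g]) (auto intro!: derivative_eq_intros)
      then have "((\<lambda>s. f (b + s *\<^sub>R y)) has_vector_derivative k (s, y)) (at s)"
        by (simp add: has_vector_derivative_def k_def)
      then show "((\<lambda>s. f (b + s *\<^sub>R y)) has_vector_derivative k (s, y)) (at s within {0..r})"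
        by (rule has_vector_derivative_at_within)
    qed (use r in simp)
    finally show ?thesis using True by simp
  qed (auto simp: W_def)
  have zero: "(\<integral>y. indicator (cball 0 1) y *\<^sub>R (f (b + r *\<^sub>R y) - f b) \<partial>lborel) = 0"
    using lborel_pair.Fubini_integral[OF int] by (simp only: radial ftc) simp
  define h where "h z = indicator (cball b r) z *\<^sub>R (f z - f b)" for z
  have "integrable lborel h" unfolding h_def
    by (intro borel_integrable_compact continuous_intros continuous_on_subset[OF contf D]) auto
  then have [measurable]: "h \<in> borel_measurable borel" by auto
  have "integral\<^sup>L lborel h = r ^ DIM('a) * (\<integral>y. h (b + r *\<^sub>R y) \<partial>lborel)"
    using r by (subst lborel_affine[of r b]) (auto simp: integral_density integral_distr)
  also have "(\<lambda>y. h (b + r *\<^sub>R y)) = (\<lambda>y. indicator (cball 0 1) y *\<^sub>R (f (b + r *\<^sub>R y) - f b))"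
    using r by (auto simp: h_def indicator_def dist_norm fun_eq_iff)
  finally show ?thesis using zero by (simp add: h_def)
qed

lemma harmonic_on_mean_value:
  fixes f :: "'a::euclidean_space \<Rightarrow> real"
  assumes f: "f harmonic_on D" and D: "cball b r \<subseteq> D"
  shows "integrable lborel (\<lambda>z. indicator (ball b r) z * f z)"
    and "(\<integral>z. indicator (ball b r) z * f z \<partial>lborel) = measure lebesgue (ball b r) * f b"
proof -
  have contf: "continuous_on (cball b r) f"
    using harmonic_on_continuous_on[OF f] D by (rule continuous_on_subset)
  have int: "integrable lborel (\<lambda>z. indicator (cball b r) z *\<^sub>R f z)"
    by (intro borel_integrable_compact contf) auto
  have eq: "indicator (ball b r) z * f z = indicator (ball b r) z * (indicator (cball b r) z *\<^sub>R f z)" for z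
    by (auto simp: indicator_def)
  show int': "integrable lborel (\<lambda>z. indicator (ball b r) z * f z)"
    unfolding eq using integrable_mult_indicator[OF _ int, of "ball b r"] by simp
  show "(\<integral>z. indicator (ball b r) z * f z \<partial>lborel) = measure lebesgue (ball b r) * f b"
  proof (cases "r > 0")
    case True
    have ic: "integrable lborel (\<lambda>z. indicator (ball b r) z * f b)"
      by (intro integrable_mult_left integrable_real_indicator emeasure_lborel_ball_finite) simp
    have "(\<integral>z. indicator (ball b r) z * f z \<partial>lborel) - (\<integral>z. indicator (ball b r) z * f b \<partial>lborel)
        = (\<integral>z. indicator (ball b r) z * f z - indicator (ball b r) z * f b \<partial>lborel)"
      by (rule Bochner_Integration.integral_diff[symmetric]) fact+
    also have "\<dots> = (\<integral>z. indicator (cball b r) z *\<^sub>R (f z - f b) \<partial>lborel)"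
    proof (rule integral_cong_AE)
      show "(\<lambda>z. indicator (ball b r) z * f z - indicator (ball b r) z * f b) \<in> borel_measurable lborel"
        using int' ic by auto
      have "integrable lborel (\<lambda>z. indicator (cball b r) z *\<^sub>R (f z - f b))"
        by (intro borel_integrable_compact continuous_intros contf) auto
      then show "(\<lambda>z. indicator (cball b r) z *\<^sub>R (f z - f b)) \<in> borel_measurable lborel" by auto
      show "AE z in lborel. indicator (ball b r) z * f z - indicator (ball b r) z * f b
          = indicator (cball b r) z *\<^sub>R (f z - f b)"
        using AE_lborel_notin_sphere[of b r]
        by eventually_elim (auto simp: indicator_def algebra_simps)
    qed
    also have "\<dots> = 0" using f D True by (rule harmonic_on_mean_value_cball)
    finally show ?thesis by simp
  qed (simp add: ball_empty)
qed

section \<open>Measurability and integration of slices\<close>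

text \<open>
  The Borel version is the limit of the functions \<open>u (x, F i y)\<close>, where the \<open>F i\<close> are simple
  functions with \<open>F i y \<longrightarrow> y\<close>.  Only the countably many slices at values of the \<open>F i\<close> matter, so
  the null sets on which these differ from Borel functions can be collected into one, \<open>N\<close>.
\<close>

lemma caratheodory_function_borel_version:
  fixes u :: "'a::euclidean_space \<times> 'b::euclidean_space \<Rightarrow> real"
  assumes \<Omega>: "open \<Omega>"
    and meas: "\<And>y. (\<lambda>x. u (x, y)) \<in> borel_measurable (lebesgue_on {x. (x, y) \<in> \<Omega>})"
    and cont: "\<And>x. continuous_on {y. (x, y) \<in> \<Omega>} (\<lambda>y. u (x, y))"
  obtains N w where "N \<in> null_sets lborel" "w \<in> borel_measurable borel"
    "\<And>x y. x \<notin> N \<Longrightarrow> (x, y) \<in> \<Omega> \<Longrightarrow> w (x, y) = u (x, y)"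
proof -
  define v where "v y x = (if x \<in> {x. (x, y) \<in> \<Omega>} then u (x, y) else 0)" for y x
  have op: "open {x. (x, y) \<in> \<Omega>}" "open {y. (x, y) \<in> \<Omega>}" for x y
    using open_vimage[OF \<Omega> continuous_on_Pair[OF continuous_on_id continuous_on_const], of y]
      open_vimage[OF \<Omega> continuous_on_Pair[OF continuous_on_const continuous_on_id], of x]
    by (simp_all add: vimage_def)
  \<comment> \<open>Each slice, extended by zero, differs from a Borel function only on a null set.\<close>
  have v: "v y \<in> borel_measurable lebesgue" for y
    unfolding v_def using op(1) by (intro borel_measurable_if_I[OF meas]) (simp add: lborelD)
  have "\<exists>v' M. v' \<in> borel_measurable lborel \<and> M \<in> null_sets lborel \<and> (\<forall>x. x \<notin> M \<longrightarrow> v y x = v' x)" for y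
  proof -
    obtain v' where "v' \<in> borel_measurable lborel" and ae: "AE x in lborel. v y x = v' x"
      using completion_ex_borel_measurable_real[OF v] by blast
    moreover obtain M where "\<And>x. x \<in> space lborel - M \<Longrightarrow> v y x = v' x" "M \<in> null_sets lborel"
      using ae by (rule AE_E3) blast
    ultimately show ?thesis by auto
  qed
  then obtain v' M where v': "\<And>y. v' y \<in> borel_measurable lborel" "\<And>y. M y \<in> null_sets lborel"
    "\<And>y x. x \<notin> M y \<Longrightarrow> v y x = v' y x" by metis
  obtain F :: "nat \<Rightarrow> 'b \<Rightarrow> 'b" where F: "\<And>i. simple_function borel (F i)" "\<And>y. (\<lambda>i. F i y) \<longlonglongrightarrow> y"
    using borel_measurable_implies_sequence_metric[of "\<lambda>y::'b. y" borel undefined] by auto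
  have finF: "finite (range (F i))" for i using simple_functionD(1)[OF F(1)] by simp
  define Q where "Q = (\<Union>i. range (F i))"
  have "countable Q" unfolding Q_def using finF by (auto intro: countable_finite)
  define N where "N = (\<Union>q\<in>Q. M q)"
  have N: "N \<in> null_sets lborel" unfolding N_def
    using \<open>countable Q\<close> v'(2) by (rule null_sets_UN')
  then have [measurable]: "N \<in> sets borel" by auto
  define W where "W i p = indicator (\<Omega> - N \<times> UNIV) p *
      (\<Sum>q\<in>range (F i). indicator (F i -` {q}) (snd p) * v' q (fst p))" for i p
  define w where "w p = indicator (\<Omega> - N \<times> UNIV) p * u p" for p
  have "w \<in> borel_measurable borel"
  proof (rule borel_measurable_LIMSEQ_real)
    fix i
    have [measurable]: "v' q \<in> borel_measurable borel" for q using v'(1) by simp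
    have [measurable]: "F i -` {q} \<in> sets borel" for q
      using simple_functionD(2)[OF F(1), of i "{q}"] by simp
    have [measurable]: "\<Omega> \<in> sets (borel \<Otimes>\<^sub>M borel)"
      unfolding borel_prod using \<Omega> by simp
    have [measurable]: "\<Omega> - N \<times> UNIV \<in> sets (borel \<Otimes>\<^sub>M borel)"
      by (intro sets.Diff pair_measureI) simp_all
    show "W i \<in> borel_measurable borel"
      unfolding W_def[abs_def] borel_prod[symmetric] by measurable
  next
    fix p :: "'a \<times> 'b"
    obtain x y where p: "p = (x, y)" by fastforce
    show "(\<lambda>i. W i p) \<longlonglongrightarrow> w p"
    proof (cases "p \<in> \<Omega> - N \<times> UNIV")
      case True
      have "W i p = v (F i y) x" for i
      proof -
        have "W i p = (\<Sum>q\<in>range (F i). if q = F i y then v' q x else 0)"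
          using True by (auto simp: W_def p intro!: sum.cong)
        also have "\<dots> = v' (F i y) x" by (simp add: finF)
        also have "\<dots> = v (F i y) x" using True by (auto simp: v'(3) p N_def Q_def)
        finally show ?thesis .
      qed
      moreover have "(\<lambda>i. v (F i y) x) \<longlonglongrightarrow> u (x, y)"
      proof (rule Lim_transform_eventually)
        have ev: "\<forall>\<^sub>F i in sequentially. F i y \<in> {y. (x, y) \<in> \<Omega>}"
          using topological_tendstoD[OF F(2) op(2)] True by (simp add: p)
        then show "\<forall>\<^sub>F i in sequentially. u (x, F i y) = v (F i y) x"
          by eventually_elim (simp add: v_def)
        show "(\<lambda>i. u (x, F i y)) \<longlonglongrightarrow> u (x, y)"
          using continuous_on_tendsto_compose[OF cont F(2) _ ev] True by (simp add: p)
      qed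
      ultimately show ?thesis using True by (simp add: w_def p)
    qed (simp add: W_def w_def)
  qed
  then show ?thesis
    by (rule that[OF N]) (auto simp: w_def)
qed

lemma AE_lborel_fst_notin_null_set:
  assumes "N \<in> null_sets (lborel :: 'a::euclidean_space measure)"
  shows "AE p in (lborel :: ('a \<times> 'b::euclidean_space) measure). fst p \<notin> N"
proof -
  have "N \<times> UNIV \<in> null_sets (lborel \<Otimes>\<^sub>M (lborel :: 'b measure))"
    using assms by (auto simp: null_sets_def lborel.emeasure_pair_measure_Times)
  then have "AE p in (lborel :: ('a \<times> 'b) measure). p \<notin> N \<times> (UNIV :: 'b set)"
    unfolding lborel_prod by (rule AE_not_in)
  then show ?thesis by eventually_elim auto
qed

lemma ereal_integral_over_eq_lborel_integral:
  assumes int: "integrable lborel (\<lambda>x. indicator S x * w x)"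
    and eq: "AE x in lborel. x \<in> S \<longrightarrow> f x = ereal (w x)"
  shows "ereal_integral_over S f = ereal (\<integral>x. indicator S x * w x \<partial>lborel)"
proof -
  let ?h = "\<lambda>x. indicator S x * w x"
  have ip: "integrable lborel (\<lambda>x. max 0 (?h x))" "integrable lborel (\<lambda>x. max 0 (- ?h x))"
    using int by auto
  have "(\<integral>\<^sup>+x\<in>S. e2ennreal (max 0 (f x)) \<partial>lebesgue) = (\<integral>\<^sup>+x. ennreal (max 0 (?h x)) \<partial>lborel)"
    unfolding nn_integral_completion using eq
    by (intro nn_integral_cong_AE, eventually_elim)
       (auto simp: indicator_def e2ennreal_ereal ereal_max[symmetric] zero_ereal_def simp del: ereal_max)
  also have "\<dots> = ennreal (\<integral>x. max 0 (?h x) \<partial>lborel)"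
    by (rule nn_integral_eq_integral[OF ip(1)]) simp
  finally have 1: "enn2ereal (\<integral>\<^sup>+x\<in>S. e2ennreal (max 0 (f x)) \<partial>lebesgue) = ereal (\<integral>x. max 0 (?h x) \<partial>lborel)"
    by (simp add: integral_nonneg_AE)
  have "(\<integral>\<^sup>+x\<in>S. e2ennreal (max 0 (- f x)) \<partial>lebesgue) = (\<integral>\<^sup>+x. ennreal (max 0 (- ?h x)) \<partial>lborel)"
    unfolding nn_integral_completion using eq
    by (intro nn_integral_cong_AE, eventually_elim)
       (auto simp: indicator_def e2ennreal_ereal ereal_max[symmetric] zero_ereal_def simp del: ereal_max)
  also have "\<dots> = ennreal (\<integral>x. max 0 (- ?h x) \<partial>lborel)"
    by (rule nn_integral_eq_integral[OF ip(2)]) simp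
  finally have 2: "enn2ereal (\<integral>\<^sup>+x\<in>S. e2ennreal (max 0 (- f x)) \<partial>lebesgue) = ereal (\<integral>x. max 0 (- ?h x) \<partial>lborel)"
    by (simp add: integral_nonneg_AE)
  have "(\<integral>x. max 0 (?h x) \<partial>lborel) - (\<integral>x. max 0 (- ?h x) \<partial>lborel)
      = (\<integral>x. max 0 (?h x) - max 0 (- ?h x) \<partial>lborel)"
    by (rule Bochner_Integration.integral_diff[symmetric]) fact+
  also have "\<dots> = (\<integral>x. ?h x \<partial>lborel)" by (intro Bochner_Integration.integral_cong) auto
  finally show ?thesis unfolding ereal_integral_over_def 1 2 by simp
qed

section \<open>Local integrability\<close>

lemma nn_integral_abs_harmonic_le:
  fixes h :: "'a::euclidean_space \<Rightarrow> real"
  assumes "h harmonic_on D" "cball b r \<subseteq> D"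
  shows "(\<integral>\<^sup>+y. ennreal \<bar>indicator (ball b r) y * h y\<bar> \<partial>lborel)
    \<le> ennreal (measure lebesgue (ball b r)) * ennreal (max 0 (h b))
      + 2 * (\<integral>\<^sup>+y. ennreal (max 0 (- (indicator (ball b r) y * h y))) \<partial>lborel)"
proof -
  let ?m = "measure lebesgue (ball b r)"
  let ?h = "\<lambda>y. indicator (ball b r) y * h y"
  note mv = harmonic_on_mean_value[OF assms]
  have im: "integrable lborel (\<lambda>y. max 0 (- ?h y))" using mv(1) by auto
  have "(\<integral>\<^sup>+y. ennreal \<bar>?h y\<bar> \<partial>lborel) = ennreal (\<integral>y. \<bar>?h y\<bar> \<partial>lborel)"
    using mv(1) by (intro nn_integral_eq_integral) auto
  also have "(\<integral>y. \<bar>?h y\<bar> \<partial>lborel) = (\<integral>y. ?h y + 2 * max 0 (- ?h y) \<partial>lborel)"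
    by (intro Bochner_Integration.integral_cong) auto
  also have "\<dots> = (\<integral>y. ?h y \<partial>lborel) + (\<integral>y. 2 * max 0 (- ?h y) \<partial>lborel)"
    using mv(1) im by (intro Bochner_Integration.integral_add) auto
  also have "\<dots> = ?m * h b + 2 * (\<integral>y. max 0 (- ?h y) \<partial>lborel)"
    using mv(2) by simp
  also have "\<dots> \<le> ?m * max 0 (h b) + 2 * (\<integral>y. max 0 (- ?h y) \<partial>lborel)"
    by (intro add_right_mono mult_left_mono) auto
  also have "ennreal \<dots> = ennreal ?m * ennreal (max 0 (h b)) + 2 * ennreal (\<integral>y. max 0 (- ?h y) \<partial>lborel)"
    by (simp add: ennreal_plus ennreal_mult integral_nonneg_AE)
  also have "ennreal (\<integral>y. max 0 (- ?h y) \<partial>lborel) = (\<integral>\<^sup>+y. ennreal (max 0 (- ?h y)) \<partial>lborel)"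
    using im by (intro nn_integral_eq_integral[symmetric]) auto
  finally show ?thesis by (simp add: ennreal_leI)
qed

text \<open>
  The hypotheses \<open>slice\<close> and \<open>minor\<close> concern only the positive part of \<open>u\<close> on the slice through
  the centre \<open>b\<close> and the negative part of \<open>u\<close> on the cylinder.
\<close>

lemma nn_integral_abs_cylinder_finite:
  fixes u :: "'a::euclidean_space \<times> 'b::euclidean_space \<Rightarrow> real"
    and w :: "'a \<times> 'b \<Rightarrow> real"
  assumes sub: "cball a R \<times> cball b r \<subseteq> \<Omega>" and r: "0 < r"
    and harm: "\<And>x. (\<lambda>y. u (x, y)) harmonic_on {y. (x, y) \<in> \<Omega>}"
    and slice: "(\<integral>\<^sup>+x\<in>cball a R. ennreal (max 0 (u (x, b))) \<partial>lebesgue) < \<infinity>"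
    and minor: "(\<integral>\<^sup>+p\<in>cball a R \<times> cball b r. ennreal (max 0 (- u p)) \<partial>lebesgue) < \<infinity>"
    and N: "N \<in> null_sets lborel" and w: "w \<in> borel_measurable borel"
    and wu: "\<And>x y. x \<notin> N \<Longrightarrow> (x, y) \<in> \<Omega> \<Longrightarrow> w (x, y) = u (x, y)"
  shows "(\<integral>\<^sup>+p\<in>cball a R \<times> ball b r. ennreal \<bar>w p\<bar> \<partial>lborel) < \<infinity>"
proof -
  let ?m = "measure lebesgue (ball b r)"
  have [measurable]: "w \<in> borel_measurable (borel \<Otimes>\<^sub>M borel)" using w by (simp add: borel_prod)
  have [measurable]: "N \<in> sets borel" using N by auto
  have nN: "AE x in lborel. x \<notin> N" using N by (rule AE_not_in)
  define S where "S = cball a R \<times> ball b r"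
  have S[measurable]: "S \<in> sets (borel \<Otimes>\<^sub>M borel)" unfolding S_def by (intro pair_measureI) auto
  define \<psi> where "\<psi> p = ennreal (max 0 (- (indicator S p * w p)))" for p
  have [measurable]: "\<psi> \<in> borel_measurable (borel \<Otimes>\<^sub>M borel)" unfolding \<psi>_def by measurable
  have "integral\<^sup>N lborel \<psi> \<le> (\<integral>\<^sup>+p\<in>cball a R \<times> cball b r. ennreal (max 0 (- u p)) \<partial>lborel)"
  proof (rule nn_integral_mono_AE)
    show "AE p in lborel. \<psi> p \<le> ennreal (max 0 (- u p)) * indicator (cball a R \<times> cball b r) p"
      using AE_lborel_fst_notin_null_set[OF N]
    proof eventually_elim
      case (elim p)
      obtain x y where p: "p = (x, y)" by fastforce
      show ?case
      proof (cases "p \<in> S")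
        case True
        then have "p \<in> cball a R \<times> cball b r" by (auto simp: S_def)
        with sub have "p \<in> \<Omega>" by blast
        then have "w p = u p" using wu elim by (simp add: p)
        with True \<open>p \<in> cball a R \<times> cball b r\<close> show ?thesis by (simp add: \<psi>_def)
      qed (simp add: \<psi>_def)
    qed
  qed
  then have psi: "integral\<^sup>N lborel \<psi> < \<infinity>" using minor by (simp add: nn_integral_completion)
  have "(\<integral>\<^sup>+x\<in>cball a R. ennreal (max 0 (w (x, b))) \<partial>lborel) = (\<integral>\<^sup>+x\<in>cball a R. ennreal (max 0 (u (x, b))) \<partial>lborel)"
  proof (rule nn_integral_cong_AE)
    show "AE x in lborel. ennreal (max 0 (w (x, b))) * indicator (cball a R) x = ennreal (max 0 (u (x, b))) * indicator (cball a R) x"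
      using nN
    proof eventually_elim
      case (elim x)
      have "(x, b) \<in> \<Omega>" if "x \<in> cball a R" using that r by (intro subsetD[OF sub]) auto
      then show ?case using wu[OF elim, of b] by (simp add: indicator_def)
    qed
  qed
  then have slice': "(\<integral>\<^sup>+x\<in>cball a R. ennreal (max 0 (w (x, b))) \<partial>lborel) < \<infinity>"
    using slice by (simp add: nn_integral_completion)
  have wb: "(\<lambda>x. w (x, b)) \<in> borel_measurable borel" by measurable
  have [measurable]: "(\<lambda>x. ennreal (max 0 (w (x, b))) * indicator (cball a R) x) \<in> borel_measurable borel"
    using wb by (intro borel_measurable_times_ennreal borel_measurable_indicator) auto
  have "(\<integral>\<^sup>+p\<in>S. ennreal \<bar>w p\<bar> \<partial>lborel) = (\<integral>\<^sup>+x. \<integral>\<^sup>+y. ennreal \<bar>w (x, y)\<bar> * indicator S (x, y) \<partial>lborel \<partial>lborel)"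
    unfolding lborel_prod[symmetric] by (rule lborel.nn_integral_fst[symmetric]) measurable
  also have "\<dots> \<le> (\<integral>\<^sup>+x. ennreal ?m * (ennreal (max 0 (w (x, b))) * indicator (cball a R) x)
        + 2 * (\<integral>\<^sup>+y. \<psi> (x, y) \<partial>lborel) \<partial>lborel)"
  proof (rule nn_integral_mono_AE)
    show "AE x in lborel. (\<integral>\<^sup>+y. ennreal \<bar>w (x, y)\<bar> * indicator S (x, y) \<partial>lborel)
      \<le> ennreal ?m * (ennreal (max 0 (w (x, b))) * indicator (cball a R) x) + 2 * (\<integral>\<^sup>+y. \<psi> (x, y) \<partial>lborel)"
      using nN
    proof eventually_elim
      case (elim x)
      show ?case
      proof (cases "x \<in> cball a R")
        case True
        then have cb: "cball b r \<subseteq> {y. (x, y) \<in> \<Omega>}" using sub by auto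
        then have eq: "indicator S (x, y) * w (x, y) = indicator (ball b r) y * u (x, y)" for y
          using True wu[OF elim, of y] subsetD[OF cb, of y] by (auto simp: S_def indicator_def)
        have "(\<integral>\<^sup>+y. ennreal \<bar>w (x, y)\<bar> * indicator S (x, y) \<partial>lborel)
            = (\<integral>\<^sup>+y. ennreal \<bar>indicator (ball b r) y * u (x, y)\<bar> \<partial>lborel)"
          unfolding eq[symmetric] by (intro nn_integral_cong) (auto simp: indicator_def)
        moreover have "w (x, b) = u (x, b)" using wu[OF elim, of b] subsetD[OF cb, of b] r by simp
        ultimately show ?thesis
          using nn_integral_abs_harmonic_le[OF harm cb] True by (simp add: \<psi>_def eq)
      qed (simp add: S_def)
    qed
  qed
  also have "\<dots> = ennreal ?m * (\<integral>\<^sup>+x\<in>cball a R. ennreal (max 0 (w (x, b))) \<partial>lborel)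
      + 2 * (\<integral>\<^sup>+x. \<integral>\<^sup>+y. \<psi> (x, y) \<partial>lborel \<partial>lborel)"
    by (subst nn_integral_add) (auto simp: nn_integral_cmult)
  also have "(\<integral>\<^sup>+x. \<integral>\<^sup>+y. \<psi> (x, y) \<partial>lborel \<partial>lborel) = integral\<^sup>N lborel \<psi>"
    unfolding lborel_prod[symmetric] by (rule lborel.nn_integral_fst) measurable
  also have "ennreal ?m * (\<integral>\<^sup>+x\<in>cball a R. ennreal (max 0 (w (x, b))) \<partial>lborel) + 2 * integral\<^sup>N lborel \<psi> < \<infinity>"
    using psi slice' by (simp add: ennreal_mult_less_top)
  finally show ?thesis by (simp add: S_def)
qed

lemma nn_integral_compact_finite_if_locally_finite:
  fixes f :: "'a::euclidean_space \<Rightarrow> ennreal"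
  assumes "compact S" and f: "f \<in> borel_measurable borel"
    and loc: "\<And>z. z \<in> S \<Longrightarrow> \<exists>T. open T \<and> z \<in> T \<and> (\<integral>\<^sup>+x\<in>T. f x \<partial>lborel) < \<infinity>"
  shows "(\<integral>\<^sup>+x\<in>S. f x \<partial>lborel) < \<infinity>"
proof -
  obtain T where T: "\<And>z. z \<in> S \<Longrightarrow> open (T z) \<and> z \<in> T z \<and> (\<integral>\<^sup>+x\<in>T z. f x \<partial>lborel) < \<infinity>"
    using loc by metis
  obtain C where C: "C \<subseteq> S" "finite C" "S \<subseteq> (\<Union>z\<in>C. T z)"
    using compactE_image[OF \<open>compact S\<close>, of S T] T by blast
  have "(\<integral>\<^sup>+x\<in>S. f x \<partial>lborel) \<le> (\<integral>\<^sup>+x. (\<Sum>z\<in>C. f x * indicator (T z) x) \<partial>lborel)"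
  proof (rule nn_integral_mono)
    fix x
    show "f x * indicator S x \<le> (\<Sum>z\<in>C. f x * indicator (T z) x)"
    proof (cases "x \<in> S")
      case True
      then obtain z where z: "z \<in> C" "x \<in> T z" using C by auto
      then have "f x * indicator S x = f x * indicator (T z) x" using True by simp
      also have "\<dots> \<le> (\<Sum>z\<in>C. f x * indicator (T z) x)"
        using z C by (intro member_le_sum) auto
      finally show ?thesis .
    qed simp
  qed
  also have "\<dots> = (\<Sum>z\<in>C. \<integral>\<^sup>+x\<in>T z. f x \<partial>lborel)"
    using f T C by (intro nn_integral_sum) (auto intro!: borel_measurable_times_ennreal borel_measurable_indicator)
  also have "\<dots> < \<infinity>" using C T by (auto simp: ennreal_sum_less_top)
  finally show ?thesis .
qed

section \<open>The mean value inequality\<close>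

lemma quasi_nearly_subharmonic_ns_ball_integral_ge:
  fixes f :: "'a::euclidean_space \<Rightarrow> real"
  assumes qns: "quasi_nearly_subharmonic_ns K D (\<lambda>x. ereal (f x))"
    and ball: "0 < r" "cball x r \<subseteq> D"
    and int: "integrable lborel (\<lambda>z. indicator (ball x r) z * w z)"
    and eq: "AE z in lborel. z \<in> ball x r \<longrightarrow> f z = w z"
  shows "measure lebesgue (ball x r) * f x \<le> K * (\<integral>z. indicator (ball x r) z * w z \<partial>lborel)"
proof -
  let ?I = "\<integral>z. indicator (ball x r) z * w z \<partial>lborel"
  let ?c = "measure lebesgue (ball (0::'a) 1) * r ^ DIM('a)"
  have c: "measure lebesgue (ball x r) = ?c"
    using content_ball_conv_unit_ball[of r x] ball by (simp add: mult.commute)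
  have "0 < ?c" using content_ball_pos[of 1 "0::'a"] ball by simp
  have "ereal_integral_over (ball x r) (\<lambda>x. ereal (f x)) = ereal ?I"
    using int eq by (intro ereal_integral_over_eq_lborel_integral) auto
  then have "ereal (f x) \<le> ereal (K / ?c) * ereal ?I"
    using qns ball unfolding quasi_nearly_subharmonic_ns_def by metis
  then have "f x \<le> K / ?c * ?I" by simp
  then show ?thesis unfolding c using \<open>0 < ?c\<close> by (simp add: field_simps)
qed

lemma ball_Pair_iff:
  "(x, y) \<in> ball (a, b) r \<longleftrightarrow> 0 < r \<and> (dist a x)\<^sup>2 + (dist b y)\<^sup>2 < r\<^sup>2"
proof -
  have "(x, y) \<in> ball (a, b) r \<longleftrightarrow> sqrt ((dist a x)\<^sup>2 + (dist b y)\<^sup>2) < r"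
    by (simp add: dist_Pair_Pair)
  also have "\<dots> \<longleftrightarrow> 0 < r \<and> (dist a x)\<^sup>2 + (dist b y)\<^sup>2 < r\<^sup>2"
    by (smt (verit) real_less_lsqrt real_sqrt_ge_zero real_sqrt_less_mono real_sqrt_abs sum_power2_ge_zero)
  finally show ?thesis .
qed

lemma less_sqrt_iff_power2: "0 \<le> t \<Longrightarrow> t < sqrt s \<longleftrightarrow> t\<^sup>2 < (s::real)"
  by (metis real_sqrt_less_iff real_sqrt_unique)

lemma le_sqrt_imp_power2: "0 \<le> t \<Longrightarrow> 0 < sqrt s \<Longrightarrow> t \<le> sqrt s \<Longrightarrow> t\<^sup>2 \<le> (s::real)"
  by (metis power_mono real_sqrt_gt_0_iff less_imp_le real_sqrt_pow2)

text \<open>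
  For \<open>r \<le> dist a x\<close> the square root is at most zero, since \<open>sqrt\<close> is odd, and both sides fail.
\<close>

lemma ball_Pair_slice:
  assumes "0 < r"
  shows "(x, y) \<in> ball (a, b) r \<longleftrightarrow> y \<in> ball b (sqrt (r\<^sup>2 - (dist a x)\<^sup>2))"
    and "(x, y) \<in> ball (a, b) r \<longleftrightarrow> x \<in> ball a (sqrt (r\<^sup>2 - (dist b y)\<^sup>2))"
  using assms by (auto simp: ball_Pair_iff less_sqrt_iff_power2 algebra_simps simp del: mem_ball)
    (auto simp: less_sqrt_iff_power2 algebra_simps)

lemma cball_Pair_slice:
  assumes "0 < r"
  shows "0 < sqrt (r\<^sup>2 - (dist a x)\<^sup>2) \<Longrightarrow> y \<in> cball b (sqrt (r\<^sup>2 - (dist a x)\<^sup>2)) \<Longrightarrow> (x, y) \<in> cball (a, b) r"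
    and "0 < sqrt (r\<^sup>2 - (dist b y)\<^sup>2) \<Longrightarrow> x \<in> cball a (sqrt (r\<^sup>2 - (dist b y)\<^sup>2)) \<Longrightarrow> (x, y) \<in> cball (a, b) r"
proof -
  have *: "sqrt (s\<^sup>2 + t\<^sup>2) \<le> r" if "s\<^sup>2 + t\<^sup>2 \<le> r\<^sup>2" for s t :: real
    using that assms by (intro real_le_lsqrt) auto
  show "0 < sqrt (r\<^sup>2 - (dist a x)\<^sup>2) \<Longrightarrow> y \<in> cball b (sqrt (r\<^sup>2 - (dist a x)\<^sup>2)) \<Longrightarrow> (x, y) \<in> cball (a, b) r"
    using le_sqrt_imp_power2[of "dist b y" "r\<^sup>2 - (dist a x)\<^sup>2"] *[of "dist a x" "dist b y"]
    by (simp add: dist_Pair_Pair)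
  show "0 < sqrt (r\<^sup>2 - (dist b y)\<^sup>2) \<Longrightarrow> x \<in> cball a (sqrt (r\<^sup>2 - (dist b y)\<^sup>2)) \<Longrightarrow> (x, y) \<in> cball (a, b) r"
    using le_sqrt_imp_power2[of "dist a x" "r\<^sup>2 - (dist b y)\<^sup>2"] *[of "dist a x" "dist b y"]
    by (simp add: dist_Pair_Pair)
qed

text \<open>
  The mean value inequality in terms of the Borel version \<open>w\<close>; here \<open>h1\<close> is \<open>w\<close> on the ball and
  \<open>h2\<close> replaces its value at \<open>(x, y)\<close> by that at \<open>(x, y\<^sub>0)\<close>.
\<close>

lemma ball_integral_ge_from_slices:
  fixes u :: "'a::euclidean_space \<times> 'b::euclidean_space \<Rightarrow> real"
    and w :: "'a \<times> 'b \<Rightarrow> real"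
  assumes r: "0 < r" and sub: "cball (x\<^sub>0, y\<^sub>0) r \<subseteq> \<Omega>" and K: "0 < K"
    and qns: "\<And>y. quasi_nearly_subharmonic_ns K {x. (x, y) \<in> \<Omega>} (\<lambda>x. ereal (u (x, y)))"
    and harm: "\<And>x. (\<lambda>y. u (x, y)) harmonic_on {y. (x, y) \<in> \<Omega>}"
    and N: "N \<in> null_sets lborel" and w: "w \<in> borel_measurable borel"
    and wu: "\<And>x y. x \<notin> N \<Longrightarrow> (x, y) \<in> \<Omega> \<Longrightarrow> w (x, y) = u (x, y)"
    and int: "integrable lborel (\<lambda>p. indicator (ball (x\<^sub>0, y\<^sub>0) r) p * w p)"
  shows "measure lebesgue (ball (x\<^sub>0, y\<^sub>0) r) * u (x\<^sub>0, y\<^sub>0)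
    \<le> K * (\<integral>p. indicator (ball (x\<^sub>0, y\<^sub>0) r) p * w p \<partial>lborel)"
proof -
  define B where "B = ball (x\<^sub>0, y\<^sub>0) r"
  define \<rho> where "\<rho> x = sqrt (r\<^sup>2 - (dist x\<^sub>0 x)\<^sup>2)" for x
  define \<sigma> where "\<sigma> y = sqrt (r\<^sup>2 - (dist y\<^sub>0 y)\<^sup>2)" for y
  have B_fst: "indicator B (x, y) = (indicator (ball y\<^sub>0 (\<rho> x)) y :: real)" for x y
    unfolding B_def \<rho>_def by (simp only: indicator_def ball_Pair_slice(1)[OF r])
  have B_snd: "indicator B (x, y) = (indicator (ball x\<^sub>0 (\<sigma> y)) x :: real)" for x y
    unfolding B_def \<sigma>_def by (simp only: indicator_def ball_Pair_slice(2)[OF r])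
  have cb_fst: "cball y\<^sub>0 (\<rho> x) \<subseteq> {y. (x, y) \<in> \<Omega>}" if "0 < \<rho> x" for x
    using cball_Pair_slice(1)[OF r] that sub unfolding \<rho>_def by blast
  have cb_snd: "cball x\<^sub>0 (\<sigma> y) \<subseteq> {x. (x, y) \<in> \<Omega>}" if "0 < \<sigma> y" for y
    using cball_Pair_slice(2)[OF r] that sub unfolding \<sigma>_def by blast
  have nN: "AE x in lborel. x \<notin> N" using N by (rule AE_not_in)
  have [measurable]: "w \<in> borel_measurable (borel \<Otimes>\<^sub>M borel)" using w by (simp add: borel_prod)
  have [measurable]: "B \<in> sets (borel \<Otimes>\<^sub>M borel)" unfolding borel_prod B_def by simp
  define h1 where "h1 = (\<lambda>(x, y). indicator B (x, y) * w (x, y))"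
  define h2 where "h2 = (\<lambda>(x, y). indicator B (x, y) * w (x, y\<^sub>0))"
  have [measurable]: "h1 \<in> borel_measurable (borel \<Otimes>\<^sub>M borel)" "h2 \<in> borel_measurable (borel \<Otimes>\<^sub>M borel)"
    unfolding h1_def h2_def by measurable
  have int1: "integrable (lborel \<Otimes>\<^sub>M lborel) h1"
    using int by (simp add: h1_def B_def lborel_prod split_def)
  have iB: "integrable lborel (\<lambda>z. indicator (ball c s) z * (t::real))" for c :: "'c::euclidean_space" and s t
    by (intro integrable_mult_left integrable_real_indicator emeasure_lborel_ball_finite) simp
  have mean: "AE x in lborel. (\<integral>y. h1 (x, y) \<partial>lborel) = measure lebesgue (ball y\<^sub>0 (\<rho> x)) * w (x, y\<^sub>0)"
    using nN
  proof eventually_elim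
    case (elim x)
    show ?case
    proof (cases "0 < \<rho> x")
      case True
      note cb = cb_fst[OF True]
      have "(\<integral>y. h1 (x, y) \<partial>lborel) = (\<integral>y. indicator (ball y\<^sub>0 (\<rho> x)) y * u (x, y) \<partial>lborel)"
      proof (intro Bochner_Integration.integral_cong refl)
        fix y
        have "(x, y) \<in> \<Omega>" if "y \<in> ball y\<^sub>0 (\<rho> x)" using cb that ball_subset_cball by blast
        then show "h1 (x, y) = indicator (ball y\<^sub>0 (\<rho> x)) y * u (x, y)"
          unfolding h1_def split B_fst using wu[OF elim, of y] by (simp add: indicator_def)
      qed
      also have "\<dots> = measure lebesgue (ball y\<^sub>0 (\<rho> x)) * u (x, y\<^sub>0)"
        by (rule harmonic_on_mean_value[OF harm cb])
      also have "u (x, y\<^sub>0) = w (x, y\<^sub>0)" using wu[OF elim, of y\<^sub>0] subsetD[OF cb, of y\<^sub>0] True by simp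
      finally show ?thesis .
    qed (simp add: h1_def B_fst ball_empty)
  qed
  have h2_fst: "(\<integral>y. h2 (x, y) \<partial>lborel) = measure lebesgue (ball y\<^sub>0 (\<rho> x)) * w (x, y\<^sub>0)"
    "(\<integral>y. norm (h2 (x, y)) \<partial>lborel) = \<bar>measure lebesgue (ball y\<^sub>0 (\<rho> x)) * w (x, y\<^sub>0)\<bar>" for x
    by (simp_all add: h2_def B_fst abs_mult)
  \<comment> \<open>By the mean value property, the integral of \<open>\<bar>h2 (x, \<cdot>)\<bar>\<close> is the absolute value of that of
    \<open>h1 (x, \<cdot>)\<close>, so \<open>h2\<close> inherits integrability from \<open>h1\<close>.\<close>
  have int2: "integrable (lborel \<Otimes>\<^sub>M lborel) h2"
  proof (rule lborel_pair.Fubini_integrable)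
    have "integrable lborel (\<lambda>x. \<bar>\<integral>y. h1 (x, y) \<partial>lborel\<bar>)"
      using lborel_pair.integrable_fst'[OF int1] by auto
    moreover have "AE x in lborel. \<bar>\<integral>y. h1 (x, y) \<partial>lborel\<bar> = (\<integral>y. norm (h2 (x, y)) \<partial>lborel)"
      using mean by eventually_elim (simp only: h2_fst)
    ultimately show "integrable lborel (\<lambda>x. \<integral>y. norm (h2 (x, y)) \<partial>lborel)"
      by (subst integrable_cong_AE[where g="\<lambda>x. \<bar>\<integral>y. h1 (x, y) \<partial>lborel\<bar>"]) auto
    show "AE x in lborel. integrable lborel (\<lambda>y. h2 (x, y))"
      by (intro AE_I2) (simp only: h2_def split B_fst iB)
  qed measurable
  have "(\<integral>p. indicator B p * w p \<partial>lborel) = integral\<^sup>L (lborel \<Otimes>\<^sub>M lborel) h1"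
    by (simp add: h1_def lborel_prod split_def)
  also have "\<dots> = (\<integral>x. \<integral>y. h1 (x, y) \<partial>lborel \<partial>lborel)"
    by (rule lborel_pair.integral_fst'[symmetric]) fact
  also have "\<dots> = (\<integral>x. \<integral>y. h2 (x, y) \<partial>lborel \<partial>lborel)"
  proof (rule integral_cong_AE)
    show "AE x in lborel. (\<integral>y. h1 (x, y) \<partial>lborel) = (\<integral>y. h2 (x, y) \<partial>lborel)"
      using mean by (simp only: h2_fst)
  qed measurable
  also have "\<dots> = (\<integral>y. \<integral>x. h2 (x, y) \<partial>lborel \<partial>lborel)"
    using lborel_pair.Fubini_integral[of "\<lambda>x y. h2 (x, y)"] int2 by simp
  finally have eq: "(\<integral>p. indicator B p * w p \<partial>lborel) = (\<integral>y. \<integral>x. h2 (x, y) \<partial>lborel \<partial>lborel)" .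
  define c where "c = u (x\<^sub>0, y\<^sub>0)"
  have intB: "integrable (lborel \<Otimes>\<^sub>M lborel) (\<lambda>(x, y). indicator B (x, y) * c)"
    using iB[of "(x\<^sub>0, y\<^sub>0)" r c] by (simp add: lborel_prod split_def B_def)
  have "measure lebesgue B * c = (\<integral>p. indicator B p * c \<partial>lborel)"
    by (simp add: B_def)
  also have "\<dots> = (\<integral>y. \<integral>x. indicator B (x, y) * c \<partial>lborel \<partial>lborel)"
    using lborel_pair.integral_snd[OF intB, symmetric] by (simp add: lborel_prod split_def)
  also have "\<dots> \<le> (\<integral>y. K * (\<integral>x. h2 (x, y) \<partial>lborel) \<partial>lborel)"
  proof (rule integral_mono_AE)
    show "integrable lborel (\<lambda>y. \<integral>x. indicator B (x, y) * c \<partial>lborel)"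
      by (rule lborel_pair.integrable_snd[OF intB])
    show "integrable lborel (\<lambda>y. K * (\<integral>x. h2 (x, y) \<partial>lborel))"
      using lborel_pair.integrable_snd[of "\<lambda>x y. h2 (x, y)"] int2 by simp
    have "AE y in lborel. integrable lborel (\<lambda>x. h2 (x, y))"
      using lborel_pair.AE_integrable_snd[of "\<lambda>x y. h2 (x, y)"] int2 by simp
    then show "AE y in lborel. (\<integral>x. indicator B (x, y) * c \<partial>lborel) \<le> K * (\<integral>x. h2 (x, y) \<partial>lborel)"
    proof eventually_elim
      case (elim y)
      show ?case
      proof (cases "0 < \<sigma> y")
        case True
        have "\<sigma> y \<le> r" using r by (simp add: \<sigma>_def real_le_lsqrt)
        moreover have "\<sigma> y\<^sub>0 = r" using r by (simp add: \<sigma>_def)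
        ultimately have cb: "cball x\<^sub>0 (\<sigma> y) \<subseteq> {x. (x, y\<^sub>0) \<in> \<Omega>}"
          using cb_snd[of y\<^sub>0] r by (metis subset_cball subset_trans)
        have "AE x in lborel. x \<in> ball x\<^sub>0 (\<sigma> y) \<longrightarrow> u (x, y\<^sub>0) = w (x, y\<^sub>0)"
          using nN
        proof eventually_elim
          case (elim x)
          have "(x, y\<^sub>0) \<in> \<Omega>" if "x \<in> ball x\<^sub>0 (\<sigma> y)" using cb that ball_subset_cball by blast
          then show ?case using wu[OF elim] by simp
        qed
        then have "measure lebesgue (ball x\<^sub>0 (\<sigma> y)) * u (x\<^sub>0, y\<^sub>0)
            \<le> K * (\<integral>x. indicator (ball x\<^sub>0 (\<sigma> y)) x * w (x, y\<^sub>0) \<partial>lborel)"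
          using elim by (intro quasi_nearly_subharmonic_ns_ball_integral_ge[OF qns True cb]) (simp_all add: h2_def B_snd)
        then show ?thesis by (simp add: B_snd h2_def c_def)
      qed (simp add: h2_def B_snd ball_empty)
    qed
  qed
  also have "\<dots> = K * (\<integral>p. indicator B p * w p \<partial>lborel)"
    by (simp add: eq)
  finally show ?thesis by (simp add: B_def c_def)
qed

section \<open>Quasi-nearly subharmonicity from the slices\<close>

lemma quasi_nearly_subharmonic_ns_from_slices:
  fixes u :: "'a::euclidean_space \<times> 'b::euclidean_space \<Rightarrow> real"
    and \<phi> :: "'a \<times> 'b \<Rightarrow> ereal"
  assumes \<Omega>: "open \<Omega>" and K: "0 < K"
    and qns: "\<And>y. quasi_nearly_subharmonic_ns K {x. (x, y) \<in> \<Omega>} (\<lambda>x. ereal (u (x, y)))"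
    and harm: "\<And>x. (\<lambda>y. u (x, y)) harmonic_on {y. (x, y) \<in> \<Omega>}"
    and \<phi>: "\<phi> locally_integrable_on \<Omega>" "\<And>z. z \<in> \<Omega> \<Longrightarrow> - \<phi> z \<le> ereal (u z)"
  shows "quasi_nearly_subharmonic_ns K \<Omega> (\<lambda>z. ereal (u z))"
proof -
  have meas: "(\<lambda>x. u (x, y)) \<in> borel_measurable (lebesgue_on {x. (x, y) \<in> \<Omega>})" for y
  proof -
    have "(\<lambda>x. real_of_ereal (ereal (u (x, y)))) \<in> borel_measurable (lebesgue_on {x. (x, y) \<in> \<Omega>})"
      using qns[of y] unfolding quasi_nearly_subharmonic_ns_def by (intro borel_measurable_real_of_ereal) blast
    then show ?thesis by simp
  qed
  obtain N w where N: "N \<in> null_sets lborel" and w: "w \<in> borel_measurable borel"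
    and wu: "\<And>x y. x \<notin> N \<Longrightarrow> (x, y) \<in> \<Omega> \<Longrightarrow> w (x, y) = u (x, y)"
    using caratheodory_function_borel_version[OF \<Omega> meas harmonic_on_continuous_on[OF harm]] by blast
  have wu_AE: "AE p in lborel. p \<in> \<Omega> \<longrightarrow> u p = w p"
    using AE_lborel_fst_notin_null_set[OF N] by eventually_elim (auto simp: wu)
  have minor: "(\<integral>\<^sup>+p\<in>S. ennreal (max 0 (- u p)) \<partial>lebesgue) < \<infinity>" if S: "compact S" "S \<subseteq> \<Omega>" for S
  proof -
    have "(\<integral>\<^sup>+p\<in>S. ennreal (max 0 (- u p)) \<partial>lebesgue) \<le> (\<integral>\<^sup>+p\<in>S. e2ennreal \<bar>\<phi> p\<bar> \<partial>lebesgue)"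
    proof (intro nn_integral_mono)
      fix p
      show "ennreal (max 0 (- u p)) * indicator S p \<le> e2ennreal \<bar>\<phi> p\<bar> * indicator S p"
      proof (cases "p \<in> S")
        case True
        then have "- \<phi> p \<le> ereal (u p)" using S(2) \<phi>(2) by blast
        then have "ereal (max 0 (- u p)) \<le> \<bar>\<phi> p\<bar>"
          by (cases "\<phi> p") (auto simp: zero_ereal_def)
        then have "e2ennreal (ereal (max 0 (- u p))) \<le> e2ennreal \<bar>\<phi> p\<bar>" by (rule e2ennreal_mono)
        with True show ?thesis by (simp add: e2ennreal_ereal del: ereal_max)
      qed simp
    qed
    also have "\<dots> < \<infinity>" using \<phi>(1) S unfolding locally_integrable_on_def by blast
    finally show ?thesis .
  qed
  have e2: "e2ennreal \<bar>max 0 (ereal t)\<bar> = ennreal (max 0 t)" for t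
    by (auto simp: max_def e2ennreal_ereal zero_ereal_def)
  have loc: "(\<integral>\<^sup>+p\<in>S. ennreal \<bar>w p\<bar> \<partial>lborel) < \<infinity>" if S: "compact S" "S \<subseteq> \<Omega>" for S
  proof (rule nn_integral_compact_finite_if_locally_finite[OF S(1)])
    show "(\<lambda>p. ennreal \<bar>w p\<bar>) \<in> borel_measurable borel" using w by measurable
    fix z assume "z \<in> S"
    obtain a b where z: "z = (a, b)" by fastforce
    have "z \<in> \<Omega>" using \<open>z \<in> S\<close> S by blast
    then obtain A C where AC: "open A" "open C" "z \<in> A \<times> C" "A \<times> C \<subseteq> \<Omega>"
      by (rule open_prod_elim[OF \<Omega>])
    then have "a \<in> A" "b \<in> C" by (simp_all add: z)
    then obtain R r where R: "0 < R" "cball a R \<subseteq> A" and r: "0 < r" "cball b r \<subseteq> C"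
      using AC(1,2) unfolding open_contains_cball by blast
    have sub: "cball a R \<times> cball b r \<subseteq> \<Omega>" using R(2) r(2) AC(4) by blast
    have "cball a R \<subseteq> {x. (x, b) \<in> \<Omega>}" using sub r by auto
    then have slice: "(\<integral>\<^sup>+x\<in>cball a R. ennreal (max 0 (u (x, b))) \<partial>lebesgue) < \<infinity>"
      using qns[of b] compact_cball[of a R]
      unfolding quasi_nearly_subharmonic_ns_def locally_integrable_on_def e2 by blast
    have "(\<integral>\<^sup>+p\<in>cball a R \<times> ball b r. ennreal \<bar>w p\<bar> \<partial>lborel) < \<infinity>"
      by (rule nn_integral_abs_cylinder_finite[OF sub r(1) harm slice minor N w wu])
         (use sub in \<open>auto intro: compact_Times\<close>)
    then have "(\<integral>\<^sup>+p\<in>ball a R \<times> ball b r. ennreal \<bar>w p\<bar> \<partial>lborel) < \<infinity>"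
      by (rule le_less_trans[rotated]) (auto intro!: nn_integral_mono simp: indicator_def)
    then show "\<exists>T. open T \<and> z \<in> T \<and> (\<integral>\<^sup>+p\<in>T. ennreal \<bar>w p\<bar> \<partial>lborel) < \<infinity>"
      using R r by (intro exI[of _ "ball a R \<times> ball b r"]) (auto simp: z open_Times)
  qed
  have u_meas: "u \<in> borel_measurable (lebesgue_on \<Omega>)"
  proof (rule borel_measurable_if_D, rule borel_measurable_AE)
    have "(\<lambda>p. indicator \<Omega> p * w p) \<in> borel_measurable borel"
      using w \<Omega> by (intro borel_measurable_times borel_measurable_indicator) auto
    then show "(\<lambda>p. indicator \<Omega> p * w p) \<in> borel_measurable lebesgue"
      by (simp add: measurable_completion)
    show "AE p in lebesgue. indicator \<Omega> p * w p = (if p \<in> \<Omega> then u p else 0)"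
      using AE_completion[OF wu_AE] by eventually_elim auto
  qed
  have eu_meas: "(\<lambda>z. ereal (u z)) \<in> borel_measurable (lebesgue_on \<Omega>)"
    using u_meas by (rule borel_measurable_ereal)
  show ?thesis
    unfolding quasi_nearly_subharmonic_ns_def
  proof (intro conjI ballI allI impI)
    show "(\<lambda>z. ereal (u z)) \<in> borel_measurable (lebesgue_on \<Omega>)" by fact
    show "ereal (u z) < \<infinity>" for z by simp
    show "(\<lambda>z. max 0 (ereal (u z))) locally_integrable_on \<Omega>"
      unfolding locally_integrable_on_def
    proof (intro conjI allI impI)
      show "(\<lambda>z. max 0 (ereal (u z))) \<in> borel_measurable (lebesgue_on \<Omega>)"
        using eu_meas by measurable
      fix S assume S: "compact S \<and> S \<subseteq> \<Omega>"
      have "(\<integral>\<^sup>+p\<in>S. e2ennreal \<bar>max 0 (ereal (u p))\<bar> \<partial>lebesgue) \<le> (\<integral>\<^sup>+p\<in>S. ennreal \<bar>w p\<bar> \<partial>lborel)"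
        unfolding nn_integral_completion e2
      proof (rule nn_integral_mono_AE)
        show "AE p in lborel. ennreal (max 0 (u p)) * indicator S p \<le> ennreal \<bar>w p\<bar> * indicator S p"
          using wu_AE
        proof eventually_elim
          case (elim p)
          then show ?case using S by (cases "p \<in> S") (auto intro!: ennreal_leI)
        qed
      qed
      also have "\<dots> < \<infinity>" using S loc by blast
      finally show "(\<integral>\<^sup>+p\<in>S. e2ennreal \<bar>max 0 (ereal (u p))\<bar> \<partial>lebesgue) < \<infinity>" .
    qed
  next
    fix z r assume zr: "0 < r \<and> cball z r \<subseteq> \<Omega>"
    let ?c = "measure lebesgue (ball (0::'a \<times> 'b) 1) * r ^ DIM('a \<times> 'b)"
    obtain a b where z: "z = (a, b)" by fastforce
    define I where "I = (\<integral>p. indicator (ball z r) p * w p \<partial>lborel)"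
    have int: "integrable lborel (\<lambda>p. indicator (ball z r) p * w p)"
    proof (rule integrableI_bounded)
      show "(\<lambda>p. indicator (ball z r) p * w p) \<in> borel_measurable lborel"
        using w by (intro borel_measurable_times borel_measurable_indicator) auto
      have "(\<integral>\<^sup>+p. ennreal (norm (indicator (ball z r) p * w p)) \<partial>lborel) \<le> (\<integral>\<^sup>+p\<in>cball z r. ennreal \<bar>w p\<bar> \<partial>lborel)"
        by (intro nn_integral_mono) (auto simp: indicator_def)
      also have "\<dots> < \<infinity>" using zr by (intro loc) auto
      finally show "(\<integral>\<^sup>+p. ennreal (norm (indicator (ball z r) p * w p)) \<partial>lborel) < \<infinity>" .
    qed
    have "ereal_integral_over (ball z r) (\<lambda>z. ereal (u z)) = ereal I"
      unfolding I_def
    proof (rule ereal_integral_over_eq_lborel_integral[OF int])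
      show "AE p in lborel. p \<in> ball z r \<longrightarrow> ereal (u p) = ereal (w p)"
        using wu_AE
      proof eventually_elim
        case (elim p)
        have "p \<in> \<Omega>" if "p \<in> ball z r" using zr that ball_subset_cball by blast
        with elim show ?case by simp
      qed
    qed
    moreover have "measure lebesgue (ball z r) * u z \<le> K * I"
      using ball_integral_ge_from_slices[OF _ _ K qns harm N w wu] zr int
      unfolding z I_def by blast
    moreover have "measure lebesgue (ball z r) = ?c"
      using content_ball_conv_unit_ball[of r z] zr by (simp add: mult.commute)
    moreover have "0 < ?c" using content_ball_pos[of 1 "0::'a \<times> 'b"] zr by simp
    ultimately show "ereal (u z) \<le> ereal (K / ?c) * ereal_integral_over (ball z r) (\<lambda>z. ereal (u z))"
      by (simp add: field_simps)
  qed
qed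

theorem theorem2:
  fixes \<Omega> :: "((real ^ 'm) \<times> (real ^ 'n)) set"
    and K :: real
    and u :: "(real ^ 'm) \<times> (real ^ 'n) \<Rightarrow> real"
  assumes "CARD('m) \<ge> 2" and "CARD('n) \<ge> 2"
    and "K \<ge> 1"
    and "open \<Omega>" and "connected \<Omega>"
    and "\<And>y. quasi_nearly_subharmonic_ns K {x. (x, y) \<in> \<Omega>} (\<lambda>x. ereal (u (x, y)))"
    and "\<And>x. (\<lambda>y. u (x, y)) harmonic_on {y. (x, y) \<in> \<Omega>}"
    and "\<exists>\<phi> :: (real ^ 'm) \<times> (real ^ 'n) \<Rightarrow> ereal.
           (\<forall>z\<in>\<Omega>. 0 \<le> \<phi> z) \<and> \<phi> locally_integrable_on \<Omega> \<and> (\<forall>z\<in>\<Omega>. - \<phi> z \<le> ereal (u z))"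
  shows "quasi_nearly_subharmonic_ns K \<Omega> (\<lambda>z. ereal (u z))"
proof -
  obtain \<phi> :: "(real ^ 'm) \<times> (real ^ 'n) \<Rightarrow> ereal" where
    "\<phi> locally_integrable_on \<Omega>" "\<forall>z\<in>\<Omega>. - \<phi> z \<le> ereal (u z)"
    using assms(8) by blast
  then show ?thesis
    using assms(3,4,6,7) by (intro quasi_nearly_subharmonic_ns_from_slices[of \<Omega> K u \<phi>]) auto
qed

end
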